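(* Let $n\ge1$ be a fixed degree and $\omega>0$. Then $$\min_{r\in\mathcal{U}_n} \| r - \exp(\omega \cdot)\| < 2\quad\text{if and only if}\quad \omega\in(0,(n+1)\pi ).$$ Moreover, for $\omega\geq (n+1)\pi$ all $r\in\mathcal{U}_n$ attain the error $\| r - \exp(\omega \cdot)\| = 2$.
   Context: For a complex polynomial $p$ let $p^\dag(z):=\overline{p}(-z)=\overline{p(-\overline z)}$, where $\overline p$ has complex-conjugated coefficients. Let $\mathcal{U}_n:=\{p^\dag/p : p \text{ a complex polynomial of degree}\le n,\ p\not\equiv 0\}$. Rational functions are identified with their irreducible form (removable singularities are removed), so that every $r\in\mathcal{U}_n$ has no poles on $\mathrm{i}\mathbb{R}$ and $|r(\mathrm{i}x)|=1$ for $x\in\mathbb{R}$. For $r\in\mathcal{U}_n$, $\|r-\exp(\omega\cdot)\|:=\max_{x\in[-1,1]}|r(\mathrm{i}x)-\mathrm{e}^{\mathrm{i}\omega x}|$. The minimum over $\mathcal{U}_n$ is attained for every $\omega>0$. *)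

theory Defs
  imports "HOL-Analysis.Analysis" "HOL-Computational_Algebra.Computational_Algebra"
    "HOL-Computational_Algebra.Field_as_Ring"
begin

definition pdag :: "complex poly \<Rightarrow> complex poly" where
  "pdag p = map_poly cnj p \<circ>\<^sub>p [:0, -1:]"

lemma poly_pdag: "poly (pdag p) z = cnj (poly p (- cnj z))"
  by (simp add: pdag_def poly_pcompose)

definition unitary_rat :: "nat \<Rightarrow> complex poly fract set" where
  "unitary_rat n = {Fract (pdag p) p |p. degree p \<le> n \<and> p \<noteq> 0}"

(* quot_of_fract is the reduced representation (coprime, monic denominator), so that
   removable singularities are removed before evaluating. *)
definition rat_eval :: "complex poly fract \<Rightarrow> complex \<Rightarrow> complex" where
  "rat_eval r z = poly (fst (quot_of_fract r)) z / poly (snd (quot_of_fract r)) z"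

(* The maximum over [-1, 1], written as a supremum; see uerr_attained. *)
definition uerr :: "complex poly fract \<Rightarrow> real \<Rightarrow> real" where
  "uerr r \<omega> = (SUP x\<in>{-1..1::real}.
     cmod (rat_eval r (\<i> * of_real x) - exp (\<i> * of_real (\<omega> * x))))"

(* The minimum over the unitary functions of degree at most n, written as an infimum; the
   infimum is finite, since the set is nonempty and errors are nonnegative, and equals the
   minimum since the latter is attained for every omega > 0. *)
definition min_uerr :: "nat \<Rightarrow> real \<Rightarrow> real" where
  "min_uerr n \<omega> = (INF r\<in>unitary_rat n. uerr r \<omega>)"

lemma unitary_rat_imag_axis:
  assumes "r \<in> unitary_rat n"
  shows "poly (snd (quot_of_fract r)) (\<i> * of_real x) \<noteq> 0"
    and "cmod (rat_eval r (\<i> * of_real x)) = 1"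
proof -
  obtain p where p: "p \<noteq> 0" "r = Fract (pdag p) p"
    using assms by (auto simp: unitary_rat_def)
  define a where "a = fst (quot_of_fract r)"
  define b where "b = snd (quot_of_fract r)"
  have b0: "b \<noteq> 0" by (simp add: b_def)
  have "Fract a b = Fract (pdag p) p" using p(2) by (simp add: a_def b_def)
  hence eq: "a * p = pdag p * b" using b0 p(1) by (simp add: eq_fract)
  have dm: "pdag (u * v) = pdag u * pdag v" for u v
    by (simp add: poly_eq_poly_eq_iff[symmetric] fun_eq_iff poly_pdag)
  have dd: "pdag (pdag u) = u" for u
    by (simp add: poly_eq_poly_eq_iff[symmetric] fun_eq_iff poly_pdag)
  have p': "pdag p \<noteq> 0" using p(1) dd[of p] by (auto simp: pdag_def)
  have "pdag a * pdag p = p * pdag b" using arg_cong[OF eq, of pdag] by (simp add: dm dd)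
  hence "(a * p) * (pdag a * pdag p) = (pdag p * b) * (p * pdag b)" using eq by simp
  hence "(a * pdag a) * (p * pdag p) = (b * pdag b) * (p * pdag p)" by (simp only: mult_ac)
  hence "a * pdag a = b * pdag b" using p(1) p' by simp
  hence *: "poly (a * pdag a) (\<i> * of_real x) = poly (b * pdag b) (\<i> * of_real x)" by simp
  hence n: "cmod (poly a (\<i> * of_real x)) = cmod (poly b (\<i> * of_real x))"
  proof -
    have "complex_of_real ((cmod (poly a (\<i> * of_real x)))\<^sup>2)
        = complex_of_real ((cmod (poly b (\<i> * of_real x)))\<^sup>2)"
      using * unfolding complex_norm_square by (simp add: poly_pdag)
    hence "(cmod (poly a (\<i> * of_real x)))\<^sup>2 = (cmod (poly b (\<i> * of_real x)))\<^sup>2"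
      by (simp only: of_real_eq_iff)
    thus ?thesis by (simp add: power2_eq_iff_nonneg)
  qed
  have "coprime a b" by (simp add: a_def b_def coprime_quot_of_fract)
  hence b: "poly b (\<i> * of_real x) \<noteq> 0"
    using n coprime_poly_0[of a b "\<i> * of_real x"] by auto
  thus "poly (snd (quot_of_fract r)) (\<i> * of_real x) \<noteq> 0" by (simp add: b_def)
  show "cmod (rat_eval r (\<i> * of_real x)) = 1"
    using b n by (simp add: rat_eval_def norm_divide flip: a_def b_def)
qed

lemma uerr_attained:
  assumes "r \<in> unitary_rat n"
  shows "\<exists>x\<in>{-1..1}. uerr r \<omega> = cmod (rat_eval r (\<i> * of_real x) - exp (\<i> * of_real (\<omega> * x)))
    \<and> (\<forall>y\<in>{-1..1}. cmod (rat_eval r (\<i> * of_real y) - exp (\<i> * of_real (\<omega> * y))) \<le> uerr r \<omega>)"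
proof -
  let ?f = "\<lambda>x::real. cmod (rat_eval r (\<i> * of_real x) - exp (\<i> * of_real (\<omega> * x)))"
  have "continuous_on {-1..1} ?f"
    unfolding rat_eval_def
    by (intro continuous_intros ballI unitary_rat_imag_axis(1)[OF assms])
  then obtain x where x: "x \<in> {-1..1}" "\<forall>y\<in>{-1..1}. ?f y \<le> ?f x"
    using continuous_attains_sup[of "{-1..1::real}" ?f] by auto
  have "uerr r \<omega> = ?f x"
    unfolding uerr_def using x by (intro cSup_eq_maximum) auto
  with x show ?thesis by auto
qed

end

theory Submission
  imports Defs
begin

text \<open>
  On the imaginary axis \<open>p\<^sup>\<dagger>\<close> is the complex conjugate of \<open>p\<close>, so \<open>r = p\<^sup>\<dagger>/p\<close> has the values
  \<open>cnj P / P\<close> with \<open>P = p(\<i>x)\<close>. Two unimodular numbers are at distance \<open>2\<close> exactly if they are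
  antipodal; the whole proposition is about whether \<open>r(\<i>x)\<close> and \<open>exp(\<i>\<omega>x)\<close> have to become
  antipodal somewhere on \<open>[-1,1]\<close>.

  If \<open>\<omega> \<ge> (n+1)\<pi>\<close>, they have to, because \<open>r\<close> turns too slowly. Each root of \<open>p\<close> contributes to the
  phase of \<open>r(\<i>x)\<close> a term \<open>2 arctan\<close> of an affine function (or a constant), so the phase grows by at
  most \<open>2\<pi>n\<close> over any interval (\<open>imag_axis_phase\<close>), whereas \<open>\<omega>x\<close> grows by
  \<open>2\<omega> \<ge> 2\<pi>n + 2\<pi>\<close> over \<open>[-1,1]\<close>. The phase difference thus sweeps a full turn and
  passes an odd multiple of \<open>\<pi>\<close> (\<open>uerr_eq_2\<close>).

  If \<open>\<omega> < (n+1)\<pi>\<close>, no computation with phases is needed: \<open>r(\<i>x)\<close> and \<open>exp(\<i>\<omega>x)\<close> are antipodal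
  exactly if \<open>exp(\<i>\<omega>x/2) P\<close> is purely imaginary. The values of \<open>p\<close> on the imaginary axis have
  the form \<open>v + \<i>u\<close> for arbitrary real polynomials \<open>u, v\<close> of degree at most \<open>n\<close>, so
  it suffices to find such polynomials for which a combination \<open>u sin t + v cos t\<close> is positive;
  here \<open>t = \<omega>x/2 + (n+1)\<pi>/2\<close> ranges over a compact subset of the interval from \<open>0\<close> to \<open>(n+1)\<pi>\<close>.
  In that interval \<open>sin\<close> has \<open>n\<close> simple zeros, and a polynomial \<open>u\<close> with the same zeros makes
  \<open>u sin t\<close> nonnegative (\<open>sine_sign_polynomial\<close>). At its zeros \<open>u' cos t\<close> is positive, so that
  \<open>v = \<epsilon>u'\<close> with a small \<open>\<epsilon>\<close> works (\<open>compact_perturb_pos\<close>).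
\<close>

section \<open>Values on the imaginary axis\<close>

lemma rat_eval_imag_axis:
  assumes "p \<noteq> 0" and "degree p \<le> n" and "r = Fract (pdag p) p"
  shows "rat_eval r (\<i> * of_real x) * poly p (\<i> * of_real x) = cnj (poly p (\<i> * of_real x))"
proof -
  define a b where "a = fst (quot_of_fract r)" and "b = snd (quot_of_fract r)"
  have r: "r \<in> unitary_rat n"
    using assms by (auto simp: unitary_rat_def)
  have b: "poly b (\<i> * of_real x) \<noteq> 0"
    using unitary_rat_imag_axis(1)[OF r] by (simp add: b_def)
  have "Fract a b = Fract (pdag p) p"
    using assms(3) by (simp add: a_def b_def)
  hence "a * p = pdag p * b"
    using assms(1) by (simp add: eq_fract b_def)
  hence "poly (a * p) (\<i> * of_real x) = poly (pdag p * b) (\<i> * of_real x)"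
    by simp
  thus ?thesis
    using b by (simp add: rat_eval_def poly_pdag a_def[symmetric] b_def[symmetric] field_simps)
qed

lemma continuous_on_rat_eval_imag_axis:
  assumes "r \<in> unitary_rat n"
  shows "continuous_on S (\<lambda>x. rat_eval r (\<i> * of_real x))"
  unfolding rat_eval_def
  by (intro continuous_intros ballI unitary_rat_imag_axis(1)[OF assms])

section \<open>The phase of a unitary rational function\<close>

text \<open>
  For \<open>a \<noteq> 0\<close> and \<open>t = (x - b) / a\<close> the quotient of \<open>cnj (\<i>x - (a + \<i>b))\<close> by \<open>\<i>x - (a + \<i>b)\<close> is
  \<open>(1 + \<i>t) / (1 - \<i>t)\<close>, whose argument is \<open>2 arctan t\<close>. For \<open>a = 0\<close> the quotient is \<open>-1\<close>; a root
  on the imaginary axis does not move the phase.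
\<close>
lemma linear_factor_phase:
  fixes s :: complex
  obtains g :: "real \<Rightarrow> real" where "continuous_on UNIV g"
    and "\<And>a b. g b - g a \<le> 2 * pi"
    and "\<And>x. cnj (\<i> * of_real x - s) = cis (g x) * (\<i> * of_real x - s)"
proof (cases "Re s = 0")
  case True
  show ?thesis
  proof (rule that[of "\<lambda>_. pi"])
    fix x :: real
    show "cnj (\<i> * of_real x - s) = cis pi * (\<i> * of_real x - s)"
      using True by (simp add: complex_eq_iff)
  qed auto
next
  case False
  define g where "g = (\<lambda>x. 2 * arctan ((x - Im s) / Re s))"
  show ?thesis
  proof (rule that[of g])
    show "continuous_on UNIV g"
      unfolding g_def using False by (intro continuous_intros) auto
    show "g b - g a \<le> 2 * pi" for a b
      using arctan_ubound[of "(b - Im s) / Re s"] arctan_lbound[of "(a - Im s) / Re s"]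
      by (simp add: g_def)
    fix x :: real
    define y where "y = arctan ((x - Im s) / Re s)"
    have c: "cos y > 0"
      unfolding y_def using arctan_bounded by (intro cos_gt_zero_pi) auto
    have "tan y = (x - Im s) / Re s"
      by (simp add: y_def tan_arctan)
    hence *: "(x - Im s) * cos y = Re s * sin y"
      using c False by (simp add: tan_def frac_eq_eq mult.commute)
    have "cos y * (\<i> * of_real x - s) = - Re s * cis (- y)"
      using * by (simp add: complex_eq_iff algebra_simps)
    hence eq: "\<i> * of_real x - s = - (Re s / cos y) * cis (- y)"
      using c by (simp add: field_simps)
    have "cnj (\<i> * of_real x - s) = - (Re s / cos y) * cis y"
      unfolding eq by (simp add: cis_cnj)
    also have "\<dots> = cis (2 * y) * (- (Re s / cos y) * cis (- y))"
      by (simp add: cis_mult mult.left_commute)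
    finally show "cnj (\<i> * of_real x - s) = cis (g x) * (\<i> * of_real x - s)"
      unfolding eq by (simp add: g_def y_def)
  qed
qed

text \<open>
  The phase relation is stated as an identity without division, so that it stays meaningful at
  roots of \<open>p\<close> and multiplies along the factorisation of \<open>p\<close>.
\<close>
lemma imag_axis_phase:
  fixes p :: "complex poly"
  assumes "p \<noteq> 0"
  shows "\<exists>g :: real \<Rightarrow> real. continuous_on UNIV g
    \<and> (\<forall>a b. g b - g a \<le> 2 * pi * degree p)
    \<and> (\<forall>x. cnj (poly p (\<i> * of_real x)) = cis (g x) * poly p (\<i> * of_real x))"
  using assms
proof (induction "degree p" arbitrary: p)
  case 0
  obtain c where c: "p = [:c:]"
    using degree_eq_zeroE[of p] 0(1) by metis
  define R A where "R = cmod c" and "A = Arg c"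
  have pol: "c = of_real R * cis A"
    unfolding R_def A_def rcis_def[symmetric] by (rule rcis_cmod_Arg[symmetric])
  have "cis (- A) = cis (- 2 * A) * cis A"
    by (subst cis_mult) simp
  hence "cnj c = cis (- 2 * A) * c"
    unfolding pol complex_cnj_mult cis_cnj complex_cnj_complex_of_real by (simp only: mult_ac)
  thus ?case
    using c by (intro exI[of _ "\<lambda>_. - 2 * A"]) auto
next
  case (Suc m)
  have "\<not> constant (poly p)"
    using Suc.hyps(2) by (simp add: constant_degree)
  then obtain s where "poly p s = 0"
    using fundamental_theorem_of_algebra by blast
  then obtain q where q: "p = [:- s, 1:] * q"
    by (auto simp: poly_eq_0_iff_dvd dvd_def)
  have q0: "q \<noteq> 0"
    using Suc.prems q by auto
  have deg: "degree p = Suc (degree q)"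
    unfolding q using q0 by (subst degree_mult_eq) auto
  obtain g where g: "continuous_on UNIV g" "\<And>a b. g b - g a \<le> 2 * pi * degree q"
    "\<And>x. cnj (poly q (\<i> * of_real x)) = cis (g x) * poly q (\<i> * of_real x)"
    using Suc.hyps(1)[of q] Suc.hyps(2) deg q0 by auto
  obtain h where h: "continuous_on UNIV h" "\<And>a b. h b - h a \<le> 2 * pi"
    "\<And>x. cnj (\<i> * of_real x - s) = cis (h x) * (\<i> * of_real x - s)"
    using linear_factor_phase[of s] by blast
  show ?case
  proof (intro exI[of _ "\<lambda>x. g x + h x"] conjI allI)
    show "continuous_on UNIV (\<lambda>x. g x + h x)"
      using g(1) h(1) by (intro continuous_intros)
    show "g b + h b - (g a + h a) \<le> 2 * pi * degree p" for a b
      using g(2)[of b a] h(2)[of b a] by (simp add: deg algebra_simps)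
    fix x :: real
    have pe: "poly p (\<i> * of_real x) = (\<i> * of_real x - s) * poly q (\<i> * of_real x)"
      by (simp add: q algebra_simps)
    show "cnj (poly p (\<i> * of_real x)) = cis (g x + h x) * poly p (\<i> * of_real x)"
      unfolding pe complex_cnj_mult g(3) h(3) by (simp add: cis_mult[symmetric])
  qed
qed

text \<open>
  Passing from the phase of \<open>p\<close> to that of \<open>r\<close> needs a division by \<open>p\<close>, which fails at the
  finitely many roots on the imaginary axis; there the equation follows by continuity.
\<close>
lemma unitary_rat_phase:
  assumes "r \<in> unitary_rat n"
  obtains g :: "real \<Rightarrow> real" where "continuous_on UNIV g"
    and "\<And>a b. g b - g a \<le> 2 * pi * n"
    and "\<And>x. rat_eval r (\<i> * of_real x) = cis (g x)"
proof -
  obtain p where p: "p \<noteq> 0" "degree p \<le> n" "r = Fract (pdag p) p"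
    using assms by (auto simp: unitary_rat_def)
  obtain g where g: "continuous_on UNIV g" "\<And>a b. g b - g a \<le> 2 * pi * degree p"
    "\<And>x. cnj (poly p (\<i> * of_real x)) = cis (g x) * poly p (\<i> * of_real x)"
    using imag_axis_phase[OF p(1)] by blast
  let ?E = "{x. rat_eval r (\<i> * of_real x) = cis (g x)}"
  let ?Z = "{x::real. poly p (\<i> * of_real x) = 0}"
  have "inj (\<lambda>x::real. \<i> * complex_of_real x)"
    by (auto simp: inj_on_def)
  hence "finite ((\<lambda>x::real. \<i> * complex_of_real x) -` {z. poly p z = 0})"
    by (intro finite_vimageI poly_roots_finite p(1))
  hence fin: "finite ?Z"
    by (simp add: vimage_def)
  have cis_cont: "continuous_on UNIV (\<lambda>x. cis (g x))"
    unfolding cis_conv_exp using g(1) by (intro continuous_intros)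
  have "- ?Z \<subseteq> ?E"
    using rat_eval_imag_axis[OF p] g(3) by auto
  moreover have "closed ?E"
    by (intro closed_Collect_eq continuous_on_rat_eval_imag_axis[OF assms] cis_cont)
  ultimately have "closure (- ?Z) \<subseteq> ?E"
    by (rule closure_minimal)
  moreover have "closure (- ?Z) = UNIV"
    using fin by (simp add: closure_complement empty_interior_finite)
  ultimately have E: "rat_eval r (\<i> * of_real x) = cis (g x)" for x
    by blast
  show ?thesis
  proof (rule that[OF g(1) _ E])
    have "2 * pi * real (degree p) \<le> 2 * pi * n"
      using p(2) by (intro mult_left_mono) auto
    thus "g b - g a \<le> 2 * pi * n" for a b
      using g(2)[of b a] by linarith
  qed
qed

lemma uerr_eq_2:
  assumes r: "r \<in> unitary_rat n" and \<omega>: "\<omega> \<ge> (real n + 1) * pi"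
  shows "uerr r \<omega> = 2"
proof -
  obtain g where g: "continuous_on UNIV g" "\<And>a b. g b - g a \<le> 2 * pi * n"
    "\<And>x. rat_eval r (\<i> * of_real x) = cis (g x)"
    using unitary_rat_phase[OF r] by blast
  define h where "h = (\<lambda>x. \<omega> * x - g x)"
  have sweep: "h 1 - h (-1) \<ge> 2 * pi"
    using g(2)[of 1 "-1"] \<omega> by (simp add: h_def algebra_simps)
  \<comment> \<open>\<open>\<pi> + 2\<pi>k\<close> is the first odd multiple of \<open>\<pi>\<close> that is not below \<open>h (-1)\<close>.\<close>
  define k where "k = \<lceil>(h (-1) - pi) / (2 * pi)\<rceil>"
  have "(h (-1) - pi) / (2 * pi) \<le> k" "k < (h (-1) - pi) / (2 * pi) + 1"
    unfolding k_def by linarith+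
  hence k: "h (-1) \<le> pi + 2 * pi * k" "pi + 2 * pi * k \<le> h (-1) + 2 * pi"
    by (simp_all add: field_simps)
  have cont: "continuous_on {-1..1} h"
    unfolding h_def by (intro continuous_intros continuous_on_subset[OF g(1)]) auto
  obtain x where x: "-1 \<le> x" "x \<le> 1" "h x = pi + 2 * pi * k"
    using IVT'[of h "-1" "pi + 2 * pi * k" 1] k sweep cont by auto
  have "cis (\<omega> * x) = cis (g x) * cis (h x)"
    by (simp add: cis_mult h_def)
  also have "cis (h x) = -1"
    unfolding x(3) by (simp add: complex_eq_iff cos_add sin_add cos_int_2pin sin_int_2pin)
  finally have "exp (\<i> * of_real (\<omega> * x)) = - cis (g x)"
    by (simp add: cis_conv_exp)
  hence "cmod (rat_eval r (\<i> * of_real x) - exp (\<i> * of_real (\<omega> * x))) = cmod (2 * cis (g x))"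
    by (simp add: g(3))
  hence "cmod (rat_eval r (\<i> * of_real x) - exp (\<i> * of_real (\<omega> * x))) = 2"
    by (simp add: norm_mult)
  hence ge: "2 \<le> uerr r \<omega>"
    using uerr_attained[OF r, of \<omega>] x(1,2) by force
  obtain y where "uerr r \<omega> = cmod (rat_eval r (\<i> * of_real y) - exp (\<i> * of_real (\<omega> * y)))"
    using uerr_attained[OF r, of \<omega>] by blast
  also have "\<dots> \<le> cmod (rat_eval r (\<i> * of_real y)) + cmod (exp (\<i> * of_real (\<omega> * y)))"
    by (rule norm_triangle_ineq4)
  also have "\<dots> = 2"
    using unitary_rat_imag_axis(2)[OF r] by simp
  finally show ?thesis
    using ge by simp
qed

section \<open>An approximant with error below two\<close>

text \<open>
  Since \<open>r(\<i>x) exp(-\<i>\<omega>x) = cnj w / w\<close> for \<open>w = exp(\<i>\<omega>x/2) p(\<i>x)\<close>, the error at \<open>x\<close> is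
  \<open>2 \<bar>Im w\<bar> / \<bar>w\<bar>\<close>.
\<close>
lemma uerr_less_2:
  assumes "degree p \<le> n"
    and Re_nz: "\<And>x. x \<in> {-1..1} \<Longrightarrow> Re (cis (\<omega> * x / 2) * poly p (\<i> * of_real x)) \<noteq> 0"
  shows "Fract (pdag p) p \<in> unitary_rat n" and "uerr (Fract (pdag p) p) \<omega> < 2"
proof -
  let ?r = "Fract (pdag p) p"
  have p0: "p \<noteq> 0"
    using Re_nz[of 0] by auto
  show r: "?r \<in> unitary_rat n"
    using p0 assms(1) by (auto simp: unitary_rat_def)
  obtain x where x: "x \<in> {-1..1}"
    "uerr ?r \<omega> = cmod (rat_eval ?r (\<i> * of_real x) - exp (\<i> * of_real (\<omega> * x)))"
    using uerr_attained[OF r, of \<omega>] by blast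
  define P where "P = poly p (\<i> * of_real x)"
  define c where "c = cis (\<omega> * x / 2)"
  define w where "w = c * P"
  have Rew: "Re w \<noteq> 0"
    using Re_nz[OF x(1)] by (simp add: w_def c_def P_def)
  have c: "cnj c * c = 1" "cmod c = 1"
    by (simp_all add: c_def cis_cnj cis_mult)
  have e: "exp (\<i> * of_real (\<omega> * x)) = c * c"
    unfolding c_def cis_mult by (simp add: cis_conv_exp)
  have "(rat_eval ?r (\<i> * of_real x) - exp (\<i> * of_real (\<omega> * x))) * P = cnj P - c * c * P"
    unfolding e P_def left_diff_distrib rat_eval_imag_axis[OF p0 assms(1) refl] ..
  also have "\<dots> = c * (cnj w - w)"
    using c(1) by (simp add: w_def algebra_simps)
  finally have "uerr ?r \<omega> * cmod P = cmod (c * (cnj w - w))"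
    by (simp only: x(2) norm_mult[symmetric])
  also have "cnj w - w = \<i> * of_real (- 2 * Im w)"
    by (simp add: complex_eq_iff)
  also have "cmod (c * \<dots>) = 2 * \<bar>Im w\<bar>"
    unfolding norm_mult c(2) norm_of_real by simp
  also have "\<dots> < 2 * cmod w"
    using Rew by (simp add: cmod_def real_less_rsqrt)
  also have "cmod w = cmod P"
    using c(2) by (simp add: w_def norm_mult)
  finally show "uerr ?r \<omega> < 2"
    by (auto simp: mult_less_cancel_right)
qed

text \<open>
  The witness is \<open>u(t) = (\<pi> - t) (2\<pi> - t) \<dots> (n\<pi> - t)\<close>. Its factor \<open>\<pi> - t\<close> together with the shift by
  \<open>\<pi>\<close>, under which \<open>sin\<close> and \<open>cos\<close> change sign, reduces \<open>n + 1\<close> to \<open>n\<close>; positivity of \<open>u\<close> left of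
  \<open>\<pi>\<close> settles the part of the interval that the shift does not reach, and also the sign of the
  derivative at \<open>\<pi>\<close>.
\<close>
lemma sine_sign_polynomial:
  "\<exists>u :: real poly. degree u \<le> n \<and> (\<forall>t<pi. poly u t > 0)
    \<and> (\<forall>t. 0 < t \<and> t < (real n + 1) * pi \<longrightarrow>
          poly u t * sin t > 0 \<or> poly u t = 0 \<and> poly (pderiv u) t * cos t > 0)"
proof (induction n)
  case 0
  show ?case
    by (intro exI[of _ 1]) (auto intro: sin_gt_zero)
next
  case (Suc n)
  then obtain u :: "real poly" where u: "degree u \<le> n" "\<And>t. t < pi \<Longrightarrow> poly u t > 0"
    "\<And>t. 0 < t \<Longrightarrow> t < (real n + 1) * pi \<Longrightarrow>
        poly u t * sin t > 0 \<or> poly u t = 0 \<and> poly (pderiv u) t * cos t > 0"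
    by blast
  define v where "v = [:pi, -1:] * (u \<circ>\<^sub>p [:- pi, 1:])"
  have v: "poly v t = (pi - t) * poly u (t - pi)" for t
    by (simp add: v_def poly_pcompose algebra_simps)
  have v': "poly (pderiv v) t = (pi - t) * poly (pderiv u) (t - pi) - poly u (t - pi)" for t
    unfolding v_def pderiv_mult pderiv_pcompose by (simp add: pderiv_pCons poly_pcompose algebra_simps)
  have vpos: "poly v t > 0" if "t < pi" for t
  proof -
    have "t - pi < pi"
      using that pi_gt_zero by linarith
    thus ?thesis
      using that u(2)[of "t - pi"] by (simp add: v)
  qed
  show ?case
  proof (intro exI[of _ v] conjI allI impI vpos)
    have "degree v \<le> degree [:pi, -1:] + degree (u \<circ>\<^sub>p [:- pi, 1:])"
      unfolding v_def by (rule degree_mult_le)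
    thus "degree v \<le> Suc n"
      using u(1) by (simp add: degree_pcompose)
  next
    fix t :: real
    assume "0 < t \<and> t < (real (Suc n) + 1) * pi"
    hence t: "0 < t" "t - pi < (real n + 1) * pi"
      by (simp_all add: algebra_simps)
    consider "t < pi" | "t = pi" | "t > pi" by linarith
    thus "poly v t * sin t > 0 \<or> poly v t = 0 \<and> poly (pderiv v) t * cos t > 0"
    proof cases
      case 1
      thus ?thesis using vpos[of t] sin_gt_zero[of t] t(1) by simp
    next
      case 2
      thus ?thesis using u(2)[of 0] by (simp add: v v')
    next
      case 3
      have vs: "poly v t * sin t = (t - pi) * (poly u (t - pi) * sin (t - pi))"
        by (simp add: v algebra_simps)
      have "poly u (t - pi) * sin (t - pi) > 0
          \<or> poly u (t - pi) = 0 \<and> poly (pderiv u) (t - pi) * cos (t - pi) > 0"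
        using u(3)[of "t - pi"] 3 t(2) by simp
      thus ?thesis
      proof (elim disjE conjE)
        assume "poly u (t - pi) * sin (t - pi) > 0"
        hence "poly v t * sin t > 0"
          unfolding vs by (rule mult_pos_pos[rotated]) (use 3 in simp)
        thus ?thesis ..
      next
        assume z: "poly u (t - pi) = 0" and pos: "poly (pderiv u) (t - pi) * cos (t - pi) > 0"
        have "(t - pi) * (poly (pderiv u) (t - pi) * cos (t - pi)) > 0"
          using pos by (rule mult_pos_pos[rotated]) (use 3 in simp)
        also have "\<dots> = poly (pderiv v) t * cos t"
          by (simp add: v' z algebra_simps)
        finally show ?thesis
          using z by (simp add: v)
      qed
    qed
  qed
qed

text \<open>
  Where \<open>G\<close> is positive nothing can go wrong; on the compact rest \<open>F\<close> is bounded away from \<open>0\<close>, and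
  a small multiple of \<open>G\<close> cannot outweigh it.
\<close>
lemma compact_perturb_pos:
  fixes F G :: "'a::t2_space \<Rightarrow> real"
  assumes K: "compact K" and F: "continuous_on K F" and G: "continuous_on K G"
    and pos: "\<And>t. t \<in> K \<Longrightarrow> F t > 0 \<or> F t = 0 \<and> G t > 0"
  obtains \<epsilon> where "\<And>t. t \<in> K \<Longrightarrow> F t + \<epsilon> * G t > 0"
proof -
  define S where "S = {t \<in> K. G t \<le> 0}"
  have "closedin (top_of_set K) (K \<inter> G -` {..0})"
    using G by (rule continuous_closedin_preimage) simp
  hence "compact (K \<inter> G -` {..0})"
    using K closedin_compact by blast
  moreover have "K \<inter> G -` {..0} = S"
    by (auto simp: S_def)
  ultimately have S: "compact S" by simp
  show ?thesis
  proof (cases "S = {}")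
    case True
    show ?thesis
    proof (rule that[of 1])
      show "F t + 1 * G t > 0" if "t \<in> K" for t
        using pos[OF that] True that by (force simp: S_def)
    qed
  next
    case False
    have sub: "S \<subseteq> K" by (auto simp: S_def)
    obtain a where a: "a \<in> S" "\<And>t. t \<in> S \<Longrightarrow> F a \<le> F t"
      using continuous_attains_inf[OF S False continuous_on_subset[OF F sub]] by blast
    obtain b where b: "b \<in> S" "\<And>t. t \<in> S \<Longrightarrow> G b \<le> G t"
      using continuous_attains_inf[OF S False continuous_on_subset[OF G sub]] by blast
    have Fa: "F a > 0"
      using pos[of a] a(1) by (auto simp: S_def)
    have Gb: "G b \<le> 0"
      using b(1) by (simp add: S_def)
    define e where "e = F a / (1 - G b)"
    have e: "e > 0" "F a + e * G b = e"
      using Fa Gb by (simp_all add: e_def field_simps)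
    show ?thesis
    proof (rule that[of e])
      fix t
      assume t: "t \<in> K"
      show "F t + e * G t > 0"
      proof (cases "t \<in> S")
        case True
        have "e * G b \<le> e * G t"
          using e(1) b(2)[OF True] by (intro mult_left_mono) auto
        thus ?thesis
          using e a(2)[OF True] by linarith
      next
        case False
        hence "e * G t > 0"
          using t e(1) by (simp add: S_def)
        thus ?thesis
          using pos[OF t] by linarith
      qed
    qed
  qed
qed

lemma exists_uerr_less_2:
  assumes "\<omega> > 0" and "\<omega> < (real n + 1) * pi"
  shows "\<exists>r\<in>unitary_rat n. uerr r \<omega> < 2"
proof -
  obtain u :: "real poly" where u: "degree u \<le> n"
    "\<And>t. 0 < t \<Longrightarrow> t < (real n + 1) * pi \<Longrightarrow>
        poly u t * sin t > 0 \<or> poly u t = 0 \<and> poly (pderiv u) t * cos t > 0"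
    using sine_sign_polynomial[of n] by blast
  define \<beta> where "\<beta> = (real n + 1) * pi / 2"
  define K where "K = {\<beta> - \<omega> / 2..\<beta> + \<omega> / 2}"
  have K: "0 < t" "t < (real n + 1) * pi" if "t \<in> K" for t
    using that assms(2) by (auto simp: K_def \<beta>_def)
  obtain e where e: "\<And>t. t \<in> K \<Longrightarrow> poly u t * sin t + e * (poly (pderiv u) t * cos t) > 0"
  proof (rule compact_perturb_pos[of K "\<lambda>t. poly u t * sin t" "\<lambda>t. poly (pderiv u) t * cos t"])
    show "compact K" by (simp add: K_def)
    show "poly u t * sin t > 0 \<or> poly u t * sin t = 0 \<and> poly (pderiv u) t * cos t > 0"
      if "t \<in> K" for t
      using u(2)[OF K[OF that]] by auto
  qed (auto intro!: continuous_intros)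
  define q where
    "q = map_poly complex_of_real (smult e (pderiv u)) - smult \<i> (map_poly complex_of_real u)"
  \<comment> \<open>The inner polynomial takes \<open>\<i>x\<close> to \<open>t = \<omega>x/2 + \<beta>\<close>, and the constant factor completes
    \<open>exp(\<i>\<omega>x/2)\<close> to \<open>exp(\<i>t)\<close>.\<close>
  define p where "p = smult (cis \<beta>) (q \<circ>\<^sub>p [:of_real \<beta>, - \<i> * of_real (\<omega> / 2):])"
  have of_real: "poly (map_poly complex_of_real f) (of_real t) = of_real (poly f t)" for f t
    by (induction f) (auto simp: map_poly_pCons)
  have q: "poly q (of_real t) = Complex (e * poly (pderiv u) t) (- poly u t)" for t
    by (simp add: q_def of_real complex_eq_iff)
  have "degree q \<le> n"
    unfolding q_def using u(1)
    by (intro degree_diff_le)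
      (auto simp: degree_map_poly degree_pderiv intro!: order.trans[OF degree_smult_le])
  hence deg: "degree p \<le> n"
    using assms(1) by (simp add: p_def degree_pcompose)
  have nz: "Re (cis (\<omega> * x / 2) * poly p (\<i> * of_real x)) \<noteq> 0" if x: "x \<in> {-1..1}" for x
  proof -
    define t where "t = \<omega> * x / 2 + \<beta>"
    have "\<omega> * x \<le> \<omega> * 1" "\<omega> * (-1) \<le> \<omega> * x"
      using x assms(1) by (intro mult_left_mono; simp)+
    hence t: "t \<in> K"
      by (simp add: K_def t_def)
    have arg: "of_real \<beta> + \<i> * of_real x * (- \<i> * of_real (\<omega> / 2)) = complex_of_real t"
      by (simp add: t_def complex_eq_iff)
    have "poly p (\<i> * of_real x)
        = cis \<beta> * poly q (of_real \<beta> + \<i> * of_real x * (- \<i> * of_real (\<omega> / 2)))"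
      by (simp add: p_def poly_pcompose)
    hence "cis (\<omega> * x / 2) * poly p (\<i> * of_real x) = cis t * poly q (of_real t)"
      unfolding arg by (simp add: t_def cis_mult[symmetric])
    hence "Re (cis (\<omega> * x / 2) * poly p (\<i> * of_real x))
        = poly u t * sin t + e * (poly (pderiv u) t * cos t)"
      by (simp add: q algebra_simps)
    thus ?thesis
      using e[OF t] by simp
  qed
  show ?thesis
    using uerr_less_2[OF deg nz] by blast
qed

theorem proposition4p5:
  fixes n :: nat and \<omega> :: real
  assumes "n \<ge> 1" and "\<omega> > 0"
  shows "(min_uerr n \<omega> < 2 \<longleftrightarrow> \<omega> \<in> {0<..<(real n + 1) * pi})
    \<and> (\<omega> \<ge> (real n + 1) * pi \<longrightarrow> (\<forall>r\<in>unitary_rat n. uerr r \<omega> = 2))"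
proof -
  have large: "\<forall>r\<in>unitary_rat n. uerr r \<omega> = 2" if "\<omega> \<ge> (real n + 1) * pi"
    using uerr_eq_2 that by blast
  have "Fract (pdag 1) 1 \<in> unitary_rat n"
    unfolding unitary_rat_def by (intro CollectI exI[of _ 1]) simp
  hence ne: "unitary_rat n \<noteq> {}"
    by blast
  have "min_uerr n \<omega> = 2" if "\<omega> \<ge> (real n + 1) * pi"
    unfolding min_uerr_def using large[OF that] ne by simp
  moreover have "min_uerr n \<omega> < 2" if small: "\<omega> < (real n + 1) * pi"
  proof -
    obtain r where r: "r \<in> unitary_rat n" "uerr r \<omega> < 2"
      using exists_uerr_less_2[OF assms(2) small] by blast
    have "0 \<le> uerr r' \<omega>" if "r' \<in> unitary_rat n" for r'
      using uerr_attained[OF that, of \<omega>] by force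
    hence "bdd_below ((\<lambda>r. uerr r \<omega>) ` unitary_rat n)"
      by (intro bdd_belowI2)
    hence "min_uerr n \<omega> \<le> uerr r \<omega>"
      unfolding min_uerr_def using r(1) by (rule cINF_lower)
    thus ?thesis
      using r(2) by linarith
  qed
  ultimately show ?thesis
    using large assms(2) by (cases "\<omega> < (real n + 1) * pi") auto
qed

end
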